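(* Let $\imath=\sqrt{-1}$, let $a$ be a parameter, let $g_1,\dots,g_{n+2}$ be coupling constants with $g_2\neq 0$, and put $\kappa=\frac{g_1}{\sqrt{2g_2}}$. Consider the quadratic $BC_n$-Toda Hamiltonian in $x=(x_1,\dots,x_n)$ $$H^{BC_n}(x)=-\frac12\sum_{i=1}^n\frac{\partial^2}{\partial x_i^2}+g_1e^{x_1}+g_2e^{2x_1}+\sum_{k=1}^{n-1}g_{k+2}e^{x_{k+1}-x_k},$$ and the quadratic Hamiltonian of the $I_{n+1}$-Toda (Inozemtsev) chain in $z=(z_1,\dots,z_{n+1})$ $$H^{I_{n+1}}(z)=-\frac12\sum_{i=1}^{n+1}\frac{\partial^2}{\partial z_i^2}+\frac{\tilde g_1}{(e^{-z_1/2}-e^{z_1/2})^2}+\frac{\tilde g_2}{(e^{-z_1}-e^{z_1})^2}+g_3\sqrt{\tfrac{g_2}{2}}\,\bigl(e^{z_1+z_2}+e^{z_2-z_1}\bigr)+\sum_{k=2}^{n}g_{k+2}e^{z_{k+1}-z_k},$$ where $$\tilde g_1=-(2\imath a+1)\kappa,\qquad \tilde g_2=2(\imath a+\kappa)+2(\imath a+\kappa)^2.$$ Let $$Q^{*}(z;x)=\left(\frac{1-e^{z_1}}{1+e^{z_1}}\right)^{\kappa}\exp\Bigl\{-\sqrt{\tfrac{g_2}{2}}\bigl(e^{x_1+z_1}+e^{x_1-z_1}\bigr)-\sum_{i=2}^n\bigl(g_{i+1}e^{z_i-x_{i-1}}+e^{x_i-z_i}\bigr)-g_{n+2}e^{z_{n+1}-x_n}\Bigr\}$$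 and $$Q(z;x|a)=(1-e^{2z_1})^{-2\imath a}\,\exp\Bigl\{\imath a\Bigl(\sum_{i=1}^{n+1}z_i-\sum_{i=1}^{n}x_i\Bigr)\Bigr\}\,Q^{*}(z;x).$$ Then the integral operator with kernel $Q(z;x|a)$ intertwines $H^{I_{n+1}}(z)-\frac{a^2}{2}$ and $H^{BC_n}(x)$, that is: $$\Bigl(H^{I_{n+1}}(z)-\frac{a^2}{2}\Bigr)Q(z;x|a)=Q(z;x|a)\,H^{BC_n}(x).$$
   Context: Convention for intertwining relations: in an identity $H(z)\,Q(z;x)=Q(z;x)\,H'(x)$ the Hamiltonian operator on the left-hand side acts to the right, on $Q$ as a function of $z$, and the Hamiltonian on the right-hand side acts to the left, on $Q$ as a function of $x$. Since the operators here have the form $-\frac12\Delta+$potential, the relation is the identity of functions $H(z)[Q(z;x)]=H'(x)[Q(z;x)]$. Empty sums are zero.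
   Formalization: The exponent of (1-e^{2z_1}) in Q(z;x|a) is taken as -ia instead of the printed -2ia; with -2ia the relation fails for every a≠0, the two sides differing by an x_1-dependent term -2ia·sqrt(g_2/2)·e^{x_1+z_1}·Q; at a=0 both agree. *)

theory Defs
  imports "HOL-Analysis.Analysis"
begin

text \<open>
  A point \<open>x = (x\<^sub>1, \<dots>, x\<^sub>N)\<close> with real coordinates is a function \<open>nat \<Rightarrow> real\<close> of which only the
  values at \<open>1, \<dots>, N\<close> are used.  The parameter and the coupling constants are complex,
  \<open>\<kappa>\<close> and \<open>sqrt (g\<^sub>2 / 2)\<close> are formed with the principal square root, and complex powers are
  principal ones.
\<close>

definition partial_derivative ::
    "nat \<Rightarrow> ((nat \<Rightarrow> real) \<Rightarrow> complex) \<Rightarrow> (nat \<Rightarrow> real) \<Rightarrow> complex" where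
  "partial_derivative i f x = vector_derivative (\<lambda>t. f (x(i := t))) (at (x i))"

definition laplacian ::
    "nat \<Rightarrow> ((nat \<Rightarrow> real) \<Rightarrow> complex) \<Rightarrow> (nat \<Rightarrow> real) \<Rightarrow> complex" where
  "laplacian N f x = (\<Sum>i=1..N. partial_derivative i (partial_derivative i f) x)"

definition H_BC ::
    "nat \<Rightarrow> (nat \<Rightarrow> complex) \<Rightarrow> ((nat \<Rightarrow> real) \<Rightarrow> complex) \<Rightarrow> (nat \<Rightarrow> real) \<Rightarrow> complex" where
  "H_BC n g f x =
     - (1/2) * laplacian n f x
     + (g 1 * exp (x 1) + g 2 * exp (2 * x 1)
        + (\<Sum>k=1..n-1. g (k+2) * exp (x (k+1) - x k))) * f x"

definition kappa :: "(nat \<Rightarrow> complex) \<Rightarrow> complex" where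
  "kappa g = g 1 / csqrt (2 * g 2)"

definition g1_tilde :: "(nat \<Rightarrow> complex) \<Rightarrow> complex \<Rightarrow> complex" where
  "g1_tilde g a = - (2 * \<i> * a + 1) * kappa g"

definition g2_tilde :: "(nat \<Rightarrow> complex) \<Rightarrow> complex \<Rightarrow> complex" where
  "g2_tilde g a = 2 * (\<i> * a + kappa g) + 2 * (\<i> * a + kappa g)\<^sup>2"

text \<open>The operator in the \<open>n + 1\<close> variables \<open>z\<^sub>1, \<dots>, z\<^sub>n\<^sub>+\<^sub>1\<close>; its potential is singular at \<open>z\<^sub>1 = 0\<close>.\<close>

definition H_I ::
    "nat \<Rightarrow> (nat \<Rightarrow> complex) \<Rightarrow> complex \<Rightarrow>
     ((nat \<Rightarrow> real) \<Rightarrow> complex) \<Rightarrow> (nat \<Rightarrow> real) \<Rightarrow> complex" where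
  "H_I n g a f z =
     - (1/2) * laplacian (n+1) f z
     + (g1_tilde g a / (exp (- z 1 / 2) - exp (z 1 / 2))\<^sup>2
        + g2_tilde g a / (exp (- z 1) - exp (z 1))\<^sup>2
        + g 3 * csqrt (g 2 / 2) * (exp (z 1 + z 2) + exp (z 2 - z 1))
        + (\<Sum>k=2..n. g (k+2) * exp (z (k+1) - z k))) * f z"

definition Q_star ::
    "nat \<Rightarrow> (nat \<Rightarrow> complex) \<Rightarrow> (nat \<Rightarrow> real) \<Rightarrow> (nat \<Rightarrow> real) \<Rightarrow> complex" where
  "Q_star n g z x =
     complex_of_real ((1 - exp (z 1)) / (1 + exp (z 1))) powr kappa g
     * exp (- csqrt (g 2 / 2) * (exp (x 1 + z 1) + exp (x 1 - z 1))
            - (\<Sum>i=2..n. g (i+1) * exp (z i - x (i-1)) + exp (x i - z i))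
            - g (n+2) * exp (z (n+1) - x n))"

text \<open>
  The exponent of \<open>1 - e\<^sup>2\<^sup>z\<^sup>1\<close> is \<open>-\<i>a\<close>, so that together with \<open>e\<^sup>\<i>\<^sup>a\<^sup>z\<^sup>1\<close> this factor is
  \<open>(e\<^sup>-\<^sup>z\<^sup>1 - e\<^sup>z\<^sup>1)\<^sup>-\<^sup>\<i>\<^sup>a\<close> for \<open>z\<^sub>1 < 0\<close>.  The source prints \<open>-2\<i>a\<close>; with that exponent
  the two sides of the intertwining relation differ by
  \<open>2\<i>a sqrt (g\<^sub>2 / 2) exp (x\<^sub>1 + z\<^sub>1) Q\<close> plus terms independent of \<open>x\<close> times \<open>Q\<close>, so that
  the relation fails whenever \<open>a \<noteq> 0\<close>.
\<close>

definition Q_kernel ::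
    "nat \<Rightarrow> (nat \<Rightarrow> complex) \<Rightarrow> complex \<Rightarrow> (nat \<Rightarrow> real) \<Rightarrow> (nat \<Rightarrow> real) \<Rightarrow> complex" where
  "Q_kernel n g a z x =
     complex_of_real (1 - exp (2 * z 1)) powr (- \<i> * a)
     * exp (\<i> * a * ((\<Sum>i=1..n+1. z i) - (\<Sum>i=1..n. x i)))
     * Q_star n g z x"

end

theory Submission
  imports Defs
begin

text \<open>
  With \<open>A\<^sub>j = g\<^sub>j\<^sub>+\<^sub>2 exp (z\<^sub>j\<^sub>+\<^sub>1 - x\<^sub>j)\<close> for \<open>1 \<le> j \<le> n\<close>, \<open>B\<^sub>j = exp (x\<^sub>j - z\<^sub>j)\<close> for \<open>2 \<le> j \<le> n\<close>,
  \<open>B\<^sub>1 = sqrt (g\<^sub>2 / 2) (exp (x\<^sub>1 + z\<^sub>1) + exp (x\<^sub>1 - z\<^sub>1))\<close> and \<open>B\<^sub>n\<^sub>+\<^sub>1 = 0\<close>, the logarithmic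
  derivatives of the kernel are \<open>-\<i>a + A\<^sub>j - B\<^sub>j\<close> in \<open>x\<^sub>j\<close> and \<open>\<i>a - A\<^sub>j + B\<^sub>j\<^sub>+\<^sub>1\<close> in
  \<open>z\<^sub>j\<^sub>+\<^sub>1\<close>.  In the difference of the two Laplacians everything but the cross terms telescopes.
  The cross terms \<open>A\<^sub>j B\<^sub>j\<^sub>+\<^sub>1\<close> and \<open>A\<^sub>j B\<^sub>j\<close> are the Toda potentials in \<open>x\<close> and in \<open>z\<close>, with
  \<open>A\<^sub>1 B\<^sub>1\<close> giving the term \<open>exp (z\<^sub>1 + z\<^sub>2) + exp (z\<^sub>2 - z\<^sub>1)\<close>; what is left is an identity in
  \<open>z\<^sub>1\<close> and \<open>x\<^sub>1\<close>, a consequence of \<open>coth\<^sup>2 - 1/sinh\<^sup>2 = 1\<close>.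
\<close>

section \<open>Logarithmic derivatives of functions of one real variable\<close>

text \<open>Written as \<open>f' = l * f\<close> instead of a quotient, so that no nonvanishing
  condition has to be carried along; over a product the values \<open>l\<close> add.\<close>

definition log_deriv :: "(real \<Rightarrow> complex) \<Rightarrow> complex \<Rightarrow> real \<Rightarrow> bool" where
  "log_deriv f l t \<longleftrightarrow> (f has_vector_derivative l * f t) (at t)"

lemma log_deriv_const: "log_deriv (\<lambda>_. c) 0 t"
  by (simp add: log_deriv_def)

lemma log_deriv_mult:
  assumes "log_deriv f k t" "log_deriv h l t"
  shows "log_deriv (\<lambda>s. f s * h s) (k + l) t"
  using has_vector_derivative_mult[OF assms[unfolded log_deriv_def]]
  by (simp add: log_deriv_def algebra_simps)

lemma log_deriv_exp:
  assumes "(f has_vector_derivative d) (at t)"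
  shows "log_deriv (\<lambda>s. exp (f s)) d t"
  using field_vector_diff_chain_at[OF assms DERIV_exp] 
  by (simp add: log_deriv_def o_def)

text \<open>The branch cut is harmless here: on the negative half-line the imaginary part of \<open>Ln\<close> is
  constantly \<open>pi\<close>.\<close>

lemma log_deriv_powr:
  fixes r :: "real \<Rightarrow> real"
  assumes r: "(r has_real_derivative r') (at t)" and nz: "r t \<noteq> 0"
  shows "log_deriv (\<lambda>s. complex_of_real (r s) powr c) (c * of_real (r' / r t)) t"
proof -
  define \<sigma> where "\<sigma> = sgn (r t)"
  define w where "w = (if r t < 0 then \<i> * pi else 0)"
  \<comment> \<open>Near \<open>t\<close> the product \<open>\<sigma> * r s\<close> is the absolute
    value of \<open>r s\<close>, and \<open>w\<close> is the constant imaginary part of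
    \<open>Ln\<close>; so \<open>\<phi>\<close> is a differentiable form of
    \<open>c * Ln (r s)\<close>.\<close>
  define \<phi> where "\<phi> = (\<lambda>s. c * (of_real (ln (\<sigma> * r s)) + w))"
  have pos: "\<sigma> * r t > 0"
    using nz by (simp add: sgn_if \<sigma>_def)
  have "((\<lambda>s. ln (\<sigma> * r s)) has_real_derivative (\<sigma> * r') / (\<sigma> * r t)) (at t)"
    using pos by (auto intro!: derivative_eq_intros r)
  then have "((\<lambda>s. ln (\<sigma> * r s)) has_real_derivative r' / r t) (at t)"
    using pos by (cases "\<sigma> = 0") auto
  then have "((\<lambda>s. complex_of_real (ln (\<sigma> * r s))) has_vector_derivative of_real (r' / r t)) (at t)"
    by (rule has_vector_derivative_of_real)
  then have "(\<phi> has_vector_derivative c * (of_real (r' / r t) + 0)) (at t)"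
    unfolding \<phi>_def
    by (intro has_vector_derivative_mult_right has_vector_derivative_add has_vector_derivative_const)
  then have E: "log_deriv (\<lambda>s. exp (\<phi> s)) (c * of_real (r' / r t)) t"
    by (intro log_deriv_exp) simp
  have eq: "exp (\<phi> s) = complex_of_real (r s) powr c" if "\<sigma> * r s > 0" for s
  proof (cases "r t < 0")
    case True
    then have "r s < 0" using that by (simp add: sgn_if \<sigma>_def)
    then have "Ln (complex_of_real (r s)) = of_real (ln (- r s)) + \<i> * pi"
      using Ln_minus[of "of_real (- r s)"] Ln_of_real[of "- r s"] by simp
    then show ?thesis
      using True \<open>r s < 0\<close> by (simp add: \<phi>_def w_def powr_def \<sigma>_def)
  next
    case False
    then have "r s > 0" using that nz by (simp add: sgn_if \<sigma>_def)
    then show ?thesis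
      using False nz by (simp add: \<phi>_def w_def powr_def \<sigma>_def Ln_of_real)
  qed
  have "isCont (\<lambda>s. \<sigma> * r s) t"
    using DERIV_isCont[OF r] by (auto intro!: continuous_intros)
  then have "\<forall>\<^sub>F s in nhds t. \<sigma> * r s > 0"
    using pos order_tendstoD(1) by (metis continuous_at tendsto_at_iff_tendsto_nhds)
  then obtain S where "open S" "t \<in> S" and S: "\<And>s. s \<in> S \<Longrightarrow> \<sigma> * r s > 0"
    by (auto simp: eventually_nhds)
  have "((\<lambda>s. complex_of_real (r s) powr c) has_vector_derivative
      c * of_real (r' / r t) * exp (\<phi> t)) (at t)"
    using E \<open>open S\<close> \<open>t \<in> S\<close> unfolding log_deriv_def
    by (rule has_vector_derivative_transform_within_open) (simp add: eq S)
  then show ?thesis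
    using eq[OF pos] by (simp add: log_deriv_def)
qed

text \<open>From \<open>f' = l * f\<close> follows \<open>f'' = l' * f + l * (l * f)\<close>. The
  first derivative must be known around \<open>x i\<close> and not only at it, hence the open set
  \<open>S\<close>: the whole line for most variables, the punctured line for
  \<open>z 1\<close>.\<close>

lemma second_partial_derivative:
  assumes "open S" "x i \<in> S"
    and f: "\<And>t. t \<in> S \<Longrightarrow> log_deriv (\<lambda>s. f (x(i := s))) (l t) t"
    and l: "(l has_vector_derivative l') (at (x i))"
  shows "partial_derivative i (partial_derivative i f) x = (l' + (l (x i))\<^sup>2) * f x"
proof -
  have eq: "partial_derivative i f (x(i := t)) = l t * f (x(i := t))" if "t \<in> S" for t
    using f[OF that] by (simp add: partial_derivative_def log_deriv_def vector_derivative_at)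
  have "((\<lambda>t. l t * f (x(i := t))) has_vector_derivative (l' + (l (x i))\<^sup>2) * f x) (at (x i))"
    using has_vector_derivative_mult[OF l f[OF \<open>x i \<in> S\<close>, unfolded log_deriv_def]]
    by (simp add: algebra_simps power2_eq_square)
  then have "((\<lambda>t. partial_derivative i f (x(i := t))) has_vector_derivative 
      (l' + (l (x i))\<^sup>2) * f x) (at (x i))"
    by (rule has_vector_derivative_transform_within_open[OF _ \<open>open S\<close> \<open>x i \<in> S\<close>]) (simp add: eq)
  then show ?thesis
    unfolding partial_derivative_def[of i "partial_derivative i f"] by (rule vector_derivative_at)
qed

section \<open>Algebraic identities behind the cancellation\<close>

text \<open>In the difference of the \<open>j\<close>-th summands the squares of
  \<open>\<alpha>\<close> and \<open>A j\<close>, the products \<open>\<alpha> * A j\<close> and the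
  linear terms \<open>A j\<close> cancel. Apart from the cross terms there remains the increment of
  \<open>c^2 + 2 * \<alpha> * c - c\<close> from \<open>c j\<close> to
  \<open>c (j+1)\<close>.\<close>

lemma sum_squares_telescope:
  fixes A c :: "nat \<Rightarrow> complex"
  shows "(\<Sum>j=1..n. (\<alpha> - A j + c (j+1))\<^sup>2 - A j - c (j+1))
    = (\<Sum>j=1..n. (- \<alpha> + A j - c j)\<^sup>2 - A j - c j)
      + ((c (n+1))\<^sup>2 + 2 * \<alpha> * c (n+1) - c (n+1)) - ((c 1)\<^sup>2 + 2 * \<alpha> * c 1 - c 1)
      - 2 * (\<Sum>j=1..n. A j * c (j+1)) + 2 * (\<Sum>j=1..n. A j * c j)"
  by (induction n) (simp_all add: algebra_simps power2_eq_square)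

text \<open>With \<open>u = exp z\<close>, \<open>p = - coth z\<close> and \<open>q = 1 / sinh z\<close>.\<close>

lemma boundary_identity:
  fixes u s \<alpha> \<kappa> X :: complex
  assumes u: "u \<noteq> 0" "u\<^sup>2 \<noteq> 1"
  defines "p \<equiv> (1 + u\<^sup>2) / (1 - u\<^sup>2)" and "q \<equiv> - 2 * u / (1 - u\<^sup>2)"
    and "C \<equiv> s * X * (u + 1 / u)" and "D \<equiv> s * X * (u - 1 / u)"
  shows "- (1/2) * (\<alpha> * q\<^sup>2 + \<kappa> * (p * q) - C + (\<alpha> * p + \<kappa> * q - D)\<^sup>2)
      + - (2 * \<alpha> + 1) * \<kappa> / (1 / u - 2 + u)
      + (2 * (\<alpha> + \<kappa>) + 2 * (\<alpha> + \<kappa>)\<^sup>2) / (1 / u - u)\<^sup>2 + \<alpha>\<^sup>2 / 2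
    = - (1/2) * (C\<^sup>2 + 2 * \<alpha> * C - C) + 2 * s * \<kappa> * X + 2 * s\<^sup>2 * X\<^sup>2"
proof -
  define d where "d = 1 - u\<^sup>2"
  have d: "d \<noteq> 0" "1 - u\<^sup>2 = d" "1 + u\<^sup>2 = 2 - d" "u\<^sup>2 = 1 - d"
    using u by (auto simp: d_def)
  have p: "p = (2 - d) / d" and q: "q = - 2 * u / d"
    unfolding p_def q_def d by simp_all
  have inv: "u + 1 / u = (2 - d) / u" "u - 1 / u = - d / u" "1 / u - u = d / u"
    using u by (simp_all add: d_def field_simps power2_eq_square)
  have pp: "p\<^sup>2 = 1 + q\<^sup>2"
  proof -
    have "(2 - d)\<^sup>2 = d\<^sup>2 + 4 * u\<^sup>2"
      unfolding d(4) by (simp add: power2_eq_square algebra_simps)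
    then show ?thesis
      using d(1) by (simp add: p q power_divide power_mult_distrib add_divide_distrib)
  qed
  \<comment> \<open>In hyperbolic terms \<open>C = 2 * s * X * cosh z\<close> and
    \<open>D = 2 * s * X * sinh z\<close>.\<close>
  have pD: "p * D = - C" and qD: "q * D = 2 * s * X"
    using u d(1) by (simp_all add: p q C_def D_def inv)
  have "(k * (u + v))\<^sup>2 = (k * (u - v))\<^sup>2 + 4 * k\<^sup>2 * (u * v)" for k v
    by (simp add: power2_eq_square algebra_simps)
  from this[of "s * X" "1 / u"] have DD: "D\<^sup>2 = C\<^sup>2 - 4 * s\<^sup>2 * X\<^sup>2"
    using u by (simp add: C_def D_def power_mult_distrib)
  have nz: "1 - u \<noteq> 0" "1 + u \<noteq> 0"
    using u by (auto simp: add_eq_0_iff)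
  \<comment> \<open>The potential with half arguments has to be expressed through \<open>p\<close>
    and \<open>q\<close>. This is the half-angle formula
    \<open>(1 + cosh z) / sinh z ^ 2 = 1 / (2 * sinh (z/2) ^ 2)\<close>.\<close>
  have "q - p = (- 2 * u - (2 - d)) / d"
    by (simp add: p q diff_divide_distrib)
  then have "q\<^sup>2 - p * q = (q * (- 2 * u - (2 - d))) / d"
    by (simp add: power2_eq_square flip: right_diff_distrib' left_diff_distrib)
  also have "- 2 * u - (2 - d) = - (1 + u)\<^sup>2"
    by (simp add: d_def power2_eq_square algebra_simps)
  also have "q * - (1 + u)\<^sup>2 / d = 2 * u * (1 + u)\<^sup>2 / d\<^sup>2"
    by (simp add: q power2_eq_square)
  also have "d = (1 - u) * (1 + u)"
    by (simp add: d_def power2_eq_square algebra_simps)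
  finally have "q\<^sup>2 - p * q = 2 * u / (1 - u)\<^sup>2"
    using nz by (simp add: power_mult_distrib)
  moreover have "1 / u - 2 + u = (1 - u)\<^sup>2 / u"
    using u by (simp add: field_simps power2_eq_square)
  ultimately have i1: "1 / (1 / u - 2 + u) = (q\<^sup>2 - p * q) / 2"
    by simp
  have i2: "1 / (1 / u - u)\<^sup>2 = q\<^sup>2 / 4"
    by (simp add: inv q power_divide power_mult_distrib)
  \<comment> \<open>With these couplings all terms in \<open>p * q\<close> cancel, and those in
    \<open>q^2\<close> add up to \<open>\<alpha>^2 * q^2 / 2\<close>. Together with
    \<open>- \<alpha>^2 * p^2 / 2\<close> and \<open>\<alpha>^2 / 2\<close> this vanishes by
    \<open>pp\<close>, so only terms containing \<open>C\<close> or \<open>D\<close>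
    survive.\<close>
  have "- (1/2) * (\<alpha> * q\<^sup>2 + \<kappa> * (p * q) - C + (\<alpha> * p + \<kappa> * q - D)\<^sup>2)
      + - (2 * \<alpha> + 1) * \<kappa> * ((q\<^sup>2 - p * q) / 2)
      + (2 * (\<alpha> + \<kappa>) + 2 * (\<alpha> + \<kappa>)\<^sup>2) * (q\<^sup>2 / 4) + \<alpha>\<^sup>2 / 2
    = - (1/2) * (\<alpha>\<^sup>2 * (p\<^sup>2 - 1 - q\<^sup>2) - 2 * \<alpha> * (p * D) - 2 * \<kappa> * (q * D) + D\<^sup>2 - C)"
    by (simp add: field_simps power2_eq_square)
  also have "\<dots> = - (1/2) * (C\<^sup>2 + 2 * \<alpha> * C - C) + 2 * s * \<kappa> * X + 2 * s\<^sup>2 * X\<^sup>2"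
    unfolding pp pD qD DD by (simp add: field_simps)
  finally show ?thesis
    unfolding i1[symmetric] i2[symmetric] by simp
qed

section \<open>The kernel as two powers times one exponential\<close>

definition A_term ::
    "(nat \<Rightarrow> complex) \<Rightarrow> (nat \<Rightarrow> real) \<Rightarrow> (nat \<Rightarrow> real) \<Rightarrow> nat \<Rightarrow> complex" where
  "A_term g z x j = g (j+2) * complex_of_real (exp (z (j+1) - x j))"

definition B_term ::
    "nat \<Rightarrow> (nat \<Rightarrow> complex) \<Rightarrow> (nat \<Rightarrow> real) \<Rightarrow> (nat \<Rightarrow> real) \<Rightarrow> nat \<Rightarrow> complex" where
  "B_term n g z x j =
    (if j = 1 then csqrt (g 2 / 2) * complex_of_real (exp (x 1 + z 1) + exp (x 1 - z 1))
     else if j \<le> n then complex_of_real (exp (x j - z j)) else 0)"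

text \<open>The two powers are left out: they depend on \<open>z 1\<close> alone and are constant
  factors for every other variable.\<close>

definition exponent ::
    "nat \<Rightarrow> (nat \<Rightarrow> complex) \<Rightarrow> complex \<Rightarrow> (nat \<Rightarrow> real) \<Rightarrow> (nat \<Rightarrow> real) \<Rightarrow> complex" where
  "exponent n g a z x = \<i> * a * complex_of_real ((\<Sum>i=1..n+1. z i) - (\<Sum>i=1..n. x i))
     - (\<Sum>j=1..n. A_term g z x j) - (\<Sum>j=1..n. B_term n g z x j)"

lemma Q_kernel_eq:
  assumes "n \<ge> 1"
  shows "Q_kernel n g a z x =
     complex_of_real (1 - exp (2 * z 1)) powr (- \<i> * a)
     * complex_of_real ((1 - exp (z 1)) / (1 + exp (z 1))) powr kappa g
     * exp (exponent n g a z x)"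
proof -
  have A: "(\<Sum>j=1..n. A_term g z x j)
      = (\<Sum>i=2..n. g (i+1) * exp (z i - x (i-1))) + g (n+2) * exp (z (n+1) - x n)"
    using assms
  proof (induction n rule: dec_induct)
    case base
    then show ?case by (simp add: A_term_def)
  next
    \<comment> \<open>The separate last term for \<open>m\<close>,
      \<open>g (m+2) * exp (z (m+1) - x m)\<close>, becomes the summand
      \<open>i = m + 1\<close>.\<close>
    case (step m)
    then show ?case by (simp add: A_term_def)
  qed
  have "{1..n} = insert 1 {2..n}" using assms by auto
  then have B: "(\<Sum>j=1..n. B_term n g z x j)
      = csqrt (g 2 / 2) * (exp (x 1 + z 1) + exp (x 1 - z 1)) + (\<Sum>i=2..n. exp (x i - z i))"
    by (auto simp: B_term_def intro!: sum.cong)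
  have "exponent n g a z x = \<i> * a * complex_of_real ((\<Sum>i=1..n+1. z i) - (\<Sum>i=1..n. x i))
     + (- csqrt (g 2 / 2) * complex_of_real (exp (x 1 + z 1) + exp (x 1 - z 1))
        - (\<Sum>i=2..n. g (i+1) * exp (z i - x (i-1)) + exp (x i - z i))
        - g (n+2) * exp (z (n+1) - x n))"
    unfolding exponent_def A B by (simp add: sum.distrib)
  then show ?thesis
    unfolding Q_kernel_def Q_star_def by (simp only: exp_add mult_ac)
qed

section \<open>First derivatives of the exponent\<close>

text \<open>Each variable occurs in at most one summand of each sum in the exponent. The conditional
  also covers a moving index outside the range of summation.\<close>

lemma has_vector_derivative_sum_single:
  fixes f :: "real \<Rightarrow> 'i \<Rightarrow> 'a :: real_normed_vector"
  assumes "finite I" "\<And>k. k \<in> I \<Longrightarrow> k \<noteq> i \<Longrightarrow> ((\<lambda>s. f s k) has_vector_derivative 0) (at t)"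
    and "i \<in> I \<Longrightarrow> ((\<lambda>s. f s i) has_vector_derivative d) (at t)"
  shows "((\<lambda>s. \<Sum>k\<in>I. f s k) has_vector_derivative (if i \<in> I then d else 0)) (at t)"
proof -
  have "((\<lambda>s. \<Sum>k\<in>I. f s k) has_vector_derivative (\<Sum>k\<in>I. if k = i then d else 0)) (at t)"
    using assms by (intro has_vector_derivative_sum) auto
  then show ?thesis using assms(1) by simp
qed

lemma has_vector_derivative_of_real_exp:
  assumes "(f has_real_derivative d) (at t)"
  shows "((\<lambda>s. complex_of_real (exp (f s))) has_vector_derivative of_real (d * exp (f t))) (at t)"
  using assms by (auto intro!: has_vector_derivative_of_real derivative_eq_intros)

text \<open>The variable \<open>x j\<close> enters \<open>A_term\<close> only at index
  \<open>j\<close>, through \<open>exp (- x j)\<close>, and \<open>B_term\<close> only at index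
  \<open>j\<close>, through \<open>exp (x j)\<close>; this includes \<open>j = 1\<close>, where both
  exponentials carry the factor \<open>exp (x 1)\<close>. Differentiation thus only changes
  signs.\<close>

lemma kernel_term_derivatives_x:
  assumes "j \<in> {1..n}"
  shows A_term_derivative_x:
      "((\<lambda>s. A_term g z (x(j := s)) j) has_vector_derivative - A_term g z (x(j := t)) j) (at t)"
    and B_term_derivative_x:
      "((\<lambda>s. B_term n g z (x(j := s)) j) has_vector_derivative B_term n g z (x(j := t)) j) (at t)"
    and exponent_derivative_x:
      "((\<lambda>s. exponent n g a z (x(j := s))) has_vector_derivative
          - \<i> * a + A_term g z (x(j := t)) j - B_term n g z (x(j := t)) j) (at t)"
proof -
  have "((\<lambda>s. complex_of_real (exp (z (j+1) - s))) has_vector_derivative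
      of_real (- 1 * exp (z (j+1) - t))) (at t)"
    by (rule has_vector_derivative_of_real_exp) (auto intro!: derivative_eq_intros)
  from has_vector_derivative_mult_right[OF this, of "g (j+2)"]
  show A: "((\<lambda>s. A_term g z (x(j := s)) j) has_vector_derivative - A_term g z (x(j := t)) j) (at t)"
    by (simp add: A_term_def)
  have E: "((\<lambda>s. complex_of_real (exp (s - c))) has_vector_derivative
      of_real (1 * exp (t - c))) (at t)" for c
    by (rule has_vector_derivative_of_real_exp) (auto intro!: derivative_eq_intros)
  show B: "((\<lambda>s. B_term n g z (x(j := s)) j) has_vector_derivative B_term n g z (x(j := t)) j) (at t)"
  proof (cases "j = 1")
    case True
    \<comment> \<open>The two exponentials in \<open>B_term\<close> at index 1 are
      \<open>exp (s - c)\<close> for \<open>c = - z 1\<close> and \<open>c = z 1\<close>.\<close>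
    from has_vector_derivative_mult_right[OF has_vector_derivative_add[OF E[of "- z 1"] E[of "z 1"]],
        of "csqrt (g 2 / 2)"]
    show ?thesis using True by (simp add: B_term_def)
  next
    case False
    then show ?thesis using E[of "z j"] assms by (simp add: B_term_def)
  qed
  have SA: "((\<lambda>s. \<Sum>k=1..n. A_term g z (x(j := s)) k) has_vector_derivative
      (if j \<in> {1..n} then - A_term g z (x(j := t)) j else 0)) (at t)"
    by (rule has_vector_derivative_sum_single) (use A in \<open>auto simp: A_term_def\<close>)
  have B_const: "B_term n g z (x(j := s)) k = B_term n g z x k" if "k \<noteq> j" for s k
    using that by (cases "k = 1") (auto simp: B_term_def)
  have SB: "((\<lambda>s. \<Sum>k=1..n. B_term n g z (x(j := s)) k) has_vector_derivative
      (if j \<in> {1..n} then B_term n g z (x(j := t)) j else 0)) (at t)"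
    by (rule has_vector_derivative_sum_single) (use B in \<open>simp_all add: B_const\<close>)
  have "((\<lambda>s. \<Sum>k=1..n. (x(j := s)) k) has_vector_derivative (if j \<in> {1..n} then 1 else 0)) (at t)"
    by (rule has_vector_derivative_sum_single) (auto intro!: derivative_eq_intros)
  then have "((\<lambda>s. \<Sum>k=1..n. (x(j := s)) k) has_real_derivative 1) (at t)"
    using assms by (simp add: has_real_derivative_iff_has_vector_derivative)
  then have "((\<lambda>s. (\<Sum>k=1..n+1. z k) - (\<Sum>k=1..n. (x(j := s)) k)) has_real_derivative 0 - 1) (at t)"
    by (intro DERIV_diff DERIV_const)
  from has_vector_derivative_mult_right[OF has_vector_derivative_of_real[OF this], of "\<i> * a"]
  have "((\<lambda>s. \<i> * a * complex_of_real ((\<Sum>k=1..n+1. z k) - (\<Sum>k=1..n. (x(j := s)) k)))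
      has_vector_derivative \<i> * a * of_real (0 - 1)) (at t)" .
  from has_vector_derivative_diff[OF has_vector_derivative_diff[OF this SA] SB]
  show "((\<lambda>s. exponent n g a z (x(j := s))) has_vector_derivative
          - \<i> * a + A_term g z (x(j := t)) j - B_term n g z (x(j := t)) j) (at t)"
    using assms by (simp add: exponent_def)
qed

text \<open>\<open>B_term n g z x (n + 1) = 0\<close>, so the formula also covers the last variable.\<close>

lemma kernel_term_derivatives_z:
  assumes "j \<in> {1..n}"
  shows A_term_derivative_z:
      "((\<lambda>s. A_term g (z(j+1 := s)) x j) has_vector_derivative A_term g (z(j+1 := t)) x j) (at t)"
    and B_term_derivative_z:
      "((\<lambda>s. B_term n g (z(j+1 := s)) x (j+1)) has_vector_derivative
         - B_term n g (z(j+1 := t)) x (j+1)) (at t)"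
    and exponent_derivative_z:
      "((\<lambda>s. exponent n g a (z(j+1 := s)) x) has_vector_derivative
          \<i> * a - A_term g (z(j+1 := t)) x j + B_term n g (z(j+1 := t)) x (j+1)) (at t)"
proof -
  have "((\<lambda>s. complex_of_real (exp (s - x j))) has_vector_derivative
      of_real (1 * exp (t - x j))) (at t)"
    by (rule has_vector_derivative_of_real_exp) (auto intro!: derivative_eq_intros)
  from has_vector_derivative_mult_right[OF this, of "g (j+2)"]
  show A: "((\<lambda>s. A_term g (z(j+1 := s)) x j) has_vector_derivative A_term g (z(j+1 := t)) x j) (at t)"
    by (simp add: A_term_def)
  have E: "((\<lambda>s. complex_of_real (exp (x (j+1) - s))) has_vector_derivative
      of_real (- 1 * exp (x (j+1) - t))) (at t)"
    by (rule has_vector_derivative_of_real_exp) (auto intro!: derivative_eq_intros)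
  then show B: "((\<lambda>s. B_term n g (z(j+1 := s)) x (j+1)) has_vector_derivative
      - B_term n g (z(j+1 := t)) x (j+1)) (at t)"
    using assms by (auto simp: B_term_def)
  have SA: "((\<lambda>s. \<Sum>k=1..n. A_term g (z(j+1 := s)) x k) has_vector_derivative
      (if j \<in> {1..n} then A_term g (z(j+1 := t)) x j else 0)) (at t)"
    by (rule has_vector_derivative_sum_single) (use A in \<open>auto simp: A_term_def\<close>)
  have B_const: "B_term n g (z(j+1 := s)) x k = B_term n g z x k" if "k \<noteq> j+1" for s k
    using that assms by (cases "k = 1") (auto simp: B_term_def)
  have "((\<lambda>s. \<Sum>k=1..n. B_term n g (z(j+1 := s)) x k) has_vector_derivative
      (if j+1 \<in> {1..n} then - B_term n g (z(j+1 := t)) x (j+1) else 0)) (at t)"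
    by (rule has_vector_derivative_sum_single) (use B in \<open>simp_all add: B_const del: One_nat_def\<close>)
  also have "(if j+1 \<in> {1..n} then - B_term n g (z(j+1 := t)) x (j+1) else 0)
      = - B_term n g (z(j+1 := t)) x (j+1)"
    using assms by (auto simp: B_term_def)
  finally have SB: "((\<lambda>s. \<Sum>k=1..n. B_term n g (z(j+1 := s)) x k) has_vector_derivative
      - B_term n g (z(j+1 := t)) x (j+1)) (at t)" .
  have "((\<lambda>s. \<Sum>k=1..n+1. (z(j+1 := s)) k) has_vector_derivative
      (if j+1 \<in> {1..n+1} then 1 else 0)) (at t)"
    by (rule has_vector_derivative_sum_single) (auto intro!: derivative_eq_intros)
  then have "((\<lambda>s. \<Sum>k=1..n+1. (z(j+1 := s)) k) has_real_derivative 1) (at t)"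
    using assms by (simp add: has_real_derivative_iff_has_vector_derivative)
  then have "((\<lambda>s. (\<Sum>k=1..n+1. (z(j+1 := s)) k) - (\<Sum>k=1..n. x k)) has_real_derivative 1 - 0) (at t)"
    by (intro DERIV_diff DERIV_const)
  from has_vector_derivative_mult_right[OF has_vector_derivative_of_real[OF this], of "\<i> * a"]
  have "((\<lambda>s. \<i> * a * complex_of_real ((\<Sum>k=1..n+1. (z(j+1 := s)) k) - (\<Sum>k=1..n. x k)))
      has_vector_derivative \<i> * a * of_real (1 - 0)) (at t)" .
  from has_vector_derivative_diff[OF has_vector_derivative_diff[OF this SA] SB]
  show "((\<lambda>s. exponent n g a (z(j+1 := s)) x) has_vector_derivative
          \<i> * a - A_term g (z(j+1 := t)) x j + B_term n g (z(j+1 := t)) x (j+1)) (at t)"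
    using assms by (simp add: exponent_def)
qed

text \<open>The first variable is separate because \<open>B_term\<close> at index 1 contains both
  \<open>exp (z 1)\<close> and \<open>exp (- z 1)\<close>: its derivative is a difference of
  exponentials and not a multiple of itself.\<close>

lemma exponent_derivative_z1:
  assumes "n \<ge> 1"
  shows "((\<lambda>s. exponent n g a (z(1 := s)) x) has_vector_derivative
          \<i> * a - csqrt (g 2 / 2) * of_real (exp (x 1 + t) - exp (x 1 - t))) (at t)"
proof -
  have "((\<lambda>s. complex_of_real (exp (x 1 + s))) has_vector_derivative of_real (1 * exp (x 1 + t))) (at t)"
       "((\<lambda>s. complex_of_real (exp (x 1 - s))) has_vector_derivative of_real (- 1 * exp (x 1 - t))) (at t)"
    by (rule has_vector_derivative_of_real_exp; auto intro!: derivative_eq_intros)+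
  from has_vector_derivative_mult_right[OF has_vector_derivative_add[OF this], of "csqrt (g 2 / 2)"]
  have B: "((\<lambda>s. B_term n g (z(1 := s)) x 1) has_vector_derivative
      csqrt (g 2 / 2) * of_real (exp (x 1 + t) - exp (x 1 - t))) (at t)"
    by (simp add: B_term_def)
  \<comment> \<open>\<open>A_term\<close> at index \<open>j\<close> contains \<open>z (j+1)\<close>,
    so \<open>z 1\<close> would belong to index 0, which lies outside the sum.\<close>
  have SA: "((\<lambda>s. \<Sum>k=1..n. A_term g (z(1 := s)) x k) has_vector_derivative
      (if 0 \<in> {1..n} then 0 else 0)) (at t)"
    by (rule has_vector_derivative_sum_single) (auto simp: A_term_def)
  have SB: "((\<lambda>s. \<Sum>k=1..n. B_term n g (z(1 := s)) x k) has_vector_derivative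
      (if 1 \<in> {1..n} then csqrt (g 2 / 2) * of_real (exp (x 1 + t) - exp (x 1 - t)) else 0)) (at t)"
    by (rule has_vector_derivative_sum_single) (use B in \<open>auto simp: B_term_def\<close>)
  have "((\<lambda>s. \<Sum>k=1..n+1. (z(1 := s)) k) has_vector_derivative
      (if 1 \<in> {1..n+1} then 1 else 0)) (at t)"
    by (rule has_vector_derivative_sum_single) (auto intro!: derivative_eq_intros)
  then have "((\<lambda>s. \<Sum>k=1..n+1. (z(1 := s)) k) has_real_derivative 1) (at t)"
    using assms by (simp add: has_real_derivative_iff_has_vector_derivative)
  then have "((\<lambda>s. (\<Sum>k=1..n+1. (z(1 := s)) k) - (\<Sum>k=1..n. x k)) has_real_derivative 1 - 0) (at t)"
    by (intro DERIV_diff DERIV_const)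
  from has_vector_derivative_mult_right[OF has_vector_derivative_of_real[OF this], of "\<i> * a"]
  have "((\<lambda>s. \<i> * a * complex_of_real ((\<Sum>k=1..n+1. (z(1 := s)) k) - (\<Sum>k=1..n. x k)))
      has_vector_derivative \<i> * a * of_real (1 - 0)) (at t)" .
  from has_vector_derivative_diff[OF has_vector_derivative_diff[OF this SA] SB]
  show ?thesis
    using assms by (simp add: exponent_def)
qed

section \<open>Second derivatives of the kernel\<close>

lemma Q_kernel_second_derivative_x:
  assumes j: "j \<in> {1..n}"
  shows "partial_derivative j (partial_derivative j (\<lambda>x'. Q_kernel n g a z x')) x
    = ((- (\<i> * a) + A_term g z x j - B_term n g z x j)\<^sup>2 - A_term g z x j - B_term n g z x j)
      * Q_kernel n g a z x"
proof -
  have n: "n \<ge> 1" using j by simp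
  have L: "log_deriv (\<lambda>s. Q_kernel n g a z (x(j := s)))
      (- \<i> * a + A_term g z (x(j := t)) j - B_term n g z (x(j := t)) j) t" for t
    using log_deriv_mult[OF log_deriv_const log_deriv_exp[OF exponent_derivative_x[OF j]]]
    unfolding Q_kernel_eq[OF n] by simp
  have D: "((\<lambda>t. - \<i> * a + A_term g z (x(j := t)) j - B_term n g z (x(j := t)) j)
      has_vector_derivative 0 + - A_term g z (x(j := x j)) j - B_term n g z (x(j := x j)) j) (at (x j))"
    by (intro has_vector_derivative_add has_vector_derivative_diff has_vector_derivative_const
        A_term_derivative_x[OF j] B_term_derivative_x[OF j])
  show ?thesis
    using second_partial_derivative[of UNIV x "j" "\<lambda>x'. Q_kernel n g a z x'", OF _ _ L D]
    by (simp add: algebra_simps)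
qed

lemma Q_kernel_second_derivative_z:
  assumes j: "j \<in> {1..n}"
  shows "partial_derivative (j+1) (partial_derivative (j+1) (\<lambda>z'. Q_kernel n g a z' x)) z
    = ((\<i> * a - A_term g z x j + B_term n g z x (j+1))\<^sup>2 - A_term g z x j - B_term n g z x (j+1))
      * Q_kernel n g a z x"
proof -
  have n: "n \<ge> 1" and "j + 1 \<noteq> 1" using j by simp_all
  have L: "log_deriv (\<lambda>s. Q_kernel n g a (z(j+1 := s)) x)
      (\<i> * a - A_term g (z(j+1 := t)) x j + B_term n g (z(j+1 := t)) x (j+1)) t" for t
    \<comment> \<open>Since \<open>j + 1 \<noteq> 1\<close>, the powers are constant in the moving
      variable.\<close>
    using log_deriv_mult[OF log_deriv_const log_deriv_exp[OF exponent_derivative_z[OF j]]]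
      \<open>j + 1 \<noteq> 1\<close> unfolding Q_kernel_eq[OF n] by simp
  have D: "((\<lambda>t. \<i> * a - A_term g (z(j+1 := t)) x j + B_term n g (z(j+1 := t)) x (j+1))
      has_vector_derivative
      0 - A_term g (z(j+1 := z (j+1))) x j + - B_term n g (z(j+1 := z (j+1))) x (j+1)) (at (z (j+1)))"
    by (intro has_vector_derivative_add has_vector_derivative_diff has_vector_derivative_const
        A_term_derivative_z[OF j] B_term_derivative_z[OF j])
  show ?thesis
    using second_partial_derivative[of UNIV z "j+1" "\<lambda>z'. Q_kernel n g a z' x", OF _ _ L D]
    by (simp add: algebra_simps)
qed

text \<open>The linear exponent gives \<open>\<i> * a\<close>, and the power with exponent
  \<open>- \<i> * a\<close> adds \<open>2 * \<i> * a * exp (2*t) / (1 - exp (2*t))\<close>; the sum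
  is \<open>- \<i> * a * coth t\<close>. The other power contributes
  \<open>kappa g / sinh t\<close>.\<close>

lemma Q_kernel_log_deriv_z1:
  assumes n: "n \<ge> 1" and t: "t \<noteq> 0"
  shows "log_deriv (\<lambda>s. Q_kernel n g a (z(1 := s)) x)
    (\<i> * a * of_real ((1 + (exp t)\<^sup>2) / (1 - (exp t)\<^sup>2))
      + kappa g * of_real (- 2 * exp t / (1 - (exp t)\<^sup>2))
      - csqrt (g 2 / 2) * of_real (exp (x 1 + t) - exp (x 1 - t))) t"
proof -
  have nz: "1 - exp t \<noteq> 0" "1 + exp t \<noteq> 0" "1 - (exp t)\<^sup>2 \<noteq> 0"
    using t exp_gt_zero[of t] by (auto simp: power2_eq_square exp_add[symmetric] simp del: exp_gt_zero)
  have fac: "1 - (exp t)\<^sup>2 = (1 - exp t) * (1 + exp t)"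
    by (simp add: power2_eq_square algebra_simps)
  have "((\<lambda>s. 1 - exp (2 * s)) has_real_derivative - 2 * (exp t)\<^sup>2) (at t)"
    by (auto intro!: derivative_eq_intros simp: exp_double power2_eq_square)
  from log_deriv_powr[OF this, of "- \<i> * a"]
  have L1: "log_deriv (\<lambda>s. complex_of_real (1 - exp (2 * s)) powr (- \<i> * a))
      (- \<i> * a * of_real (- 2 * (exp t)\<^sup>2 / (1 - (exp t)\<^sup>2))) t"
    using nz by (simp add: exp_double)
  have "((\<lambda>s. (1 - exp s) / (1 + exp s)) has_real_derivative
      (- exp t * (1 + exp t) - (1 - exp t) * exp t) / ((1 + exp t) * (1 + exp t))) (at t)"
    using nz by (auto intro!: derivative_eq_intros)
  from log_deriv_powr[OF this, of "kappa g"]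
  have "log_deriv (\<lambda>s. complex_of_real ((1 - exp s) / (1 + exp s)) powr kappa g)
      (kappa g * of_real ((- exp t * (1 + exp t) - (1 - exp t) * exp t)
        / ((1 + exp t) * (1 + exp t)) / ((1 - exp t) / (1 + exp t)))) t"
    using nz by simp
  also have "(- exp t * (1 + exp t) - (1 - exp t) * exp t)
        / ((1 + exp t) * (1 + exp t)) / ((1 - exp t) / (1 + exp t))
      = - 2 * exp t / (1 - (exp t)\<^sup>2)"
  proof -
    have "- exp t * (1 + exp t) - (1 - exp t) * exp t = - 2 * exp t"
      by (simp add: algebra_simps)
    then show ?thesis using nz by (simp add: fac)
  qed
  finally have L2: "log_deriv (\<lambda>s. complex_of_real ((1 - exp s) / (1 + exp s)) powr kappa g)
      (kappa g * of_real (- 2 * exp t / (1 - (exp t)\<^sup>2))) t" .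
  have "1 + 2 * (exp t)\<^sup>2 / (1 - (exp t)\<^sup>2) = (1 + (exp t)\<^sup>2) / (1 - (exp t)\<^sup>2)"
    using nz(3) by (simp add: add_divide_eq_iff)
  then have p: "complex_of_real ((1 + (exp t)\<^sup>2) / (1 - (exp t)\<^sup>2))
      = 1 - of_real (- 2 * (exp t)\<^sup>2 / (1 - (exp t)\<^sup>2))"
    by (metis (no_types, opaque_lifting) of_real_1 of_real_diff minus_divide_left mult_minus_left 
        diff_minus_eq_add)
  show ?thesis
    using log_deriv_mult[OF log_deriv_mult[OF L1 L2]
        log_deriv_exp[OF exponent_derivative_z1[OF n, of g a z x t]]]
    unfolding Q_kernel_eq[OF n] p by (simp add: algebra_simps)
qed

lemma Q_kernel_second_derivative_z1:
  fixes g :: "nat \<Rightarrow> complex" and x z :: "nat \<Rightarrow> real"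
  assumes n: "n \<ge> 1" and z: "z 1 \<noteq> 0"
  defines "u \<equiv> complex_of_real (exp (z 1))" and "X \<equiv> complex_of_real (exp (x 1))"
    and "s \<equiv> csqrt (g 2 / 2)"
  defines "p \<equiv> (1 + u\<^sup>2) / (1 - u\<^sup>2)" and "q \<equiv> - 2 * u / (1 - u\<^sup>2)"
  shows "partial_derivative 1 (partial_derivative 1 (\<lambda>z'. Q_kernel n g a z' x)) z
    = (\<i> * a * q\<^sup>2 + kappa g * (p * q) - s * X * (u + 1 / u)
       + (\<i> * a * p + kappa g * q - s * X * (u - 1 / u))\<^sup>2) * Q_kernel n g a z x"
proof -
  define P where "P t = (1 + (exp t)\<^sup>2) / (1 - (exp t)\<^sup>2)" for t :: real
  define R where "R t = - 2 * exp t / (1 - (exp t)\<^sup>2)" for t :: real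
  have nz: "1 - (exp (z 1))\<^sup>2 \<noteq> 0"
    using z by (simp add: power2_eq_square exp_add[symmetric])
  \<comment> \<open>As \<open>P = - coth\<close> and \<open>R = 1 / sinh\<close>, the pair is closed
    under differentiation: \<open>P' = R^2\<close> and \<open>R' = P * R\<close>.\<close>
  have "(P has_real_derivative (R (z 1))\<^sup>2) (at (z 1))"
    unfolding P_def R_def
    by (rule derivative_eq_intros refl nz)+
      (use nz in \<open>simp add: power_divide power2_eq_square algebra_simps\<close>)
  moreover have "(R has_real_derivative P (z 1) * R (z 1)) (at (z 1))"
    unfolding P_def R_def
    by (rule derivative_eq_intros refl nz)+
      (use nz in \<open>simp add: power2_eq_square divide_simps; simp add: algebra_simps\<close>)
  moreover have "((\<lambda>t. exp (x 1 + t) - exp (x 1 - t)) has_real_derivative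
      exp (x 1 + z 1) + exp (x 1 - z 1)) (at (z 1))"
    by (auto intro!: derivative_eq_intros)
  ultimately have D: "((\<lambda>t. \<i> * a * of_real (P t) + kappa g * of_real (R t)
        - s * of_real (exp (x 1 + t) - exp (x 1 - t)))
      has_vector_derivative \<i> * a * of_real ((R (z 1))\<^sup>2) + kappa g * of_real (P (z 1) * R (z 1))
        - s * of_real (exp (x 1 + z 1) + exp (x 1 - z 1))) (at (z 1))"
    by (intro has_vector_derivative_add has_vector_derivative_diff has_vector_derivative_mult_right
        has_vector_derivative_of_real)
  have L: "log_deriv (\<lambda>s. Q_kernel n g a (z(1 := s)) x) (\<i> * a * of_real (P t) + kappa g * of_real (R t)
        - s * of_real (exp (x 1 + t) - exp (x 1 - t))) t" if "t \<in> - {0}" for t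
    using Q_kernel_log_deriv_z1[OF n, of t] that by (simp add: P_def R_def s_def)
  have "of_real (P (z 1)) = p" "of_real (R (z 1)) = q"
    by (simp_all add: P_def R_def p_def q_def u_def)
  moreover have "complex_of_real (exp (x 1 + z 1) + exp (x 1 - z 1)) = X * (u + 1 / u)"
    "complex_of_real (exp (x 1 + z 1) - exp (x 1 - z 1)) = X * (u - 1 / u)"
    by (simp_all add: X_def u_def exp_add exp_diff algebra_simps)
  ultimately show ?thesis
    using second_partial_derivative[of "- {0}" z 1 "\<lambda>z'. Q_kernel n g a z' x", OF _ _ L D] z
    by (simp add: open_Compl mult.assoc)
qed

section \<open>Matching the square roots and assembling the intertwining relation\<close>

text \<open>The arguments differ by the positive factor 4, so both roots lie on the principal
  branch. This links the root in \<open>kappa\<close> with the one in the kernel.\<close>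

lemma csqrt_double: "csqrt (2 * w) = 2 * csqrt (w / 2)"
proof (rule csqrt_unique)
  show "(2 * csqrt (w / 2))\<^sup>2 = 2 * w"
    by (simp add: power_mult_distrib)
  show "0 < Re (2 * csqrt (w / 2)) \<or> Re (2 * csqrt (w / 2)) = 0 \<and> 0 \<le> Im (2 * csqrt (w / 2))"
    using csqrt_principal[of "w / 2"] by simp
qed

theorem proposition1p5:
  fixes n :: nat and g :: "nat \<Rightarrow> complex" and a :: complex
    and x z :: "nat \<Rightarrow> real"
  assumes "n \<ge> 1" and "g 2 \<noteq> 0" and "z 1 \<noteq> 0"
  shows "H_I n g a (\<lambda>z'. Q_kernel n g a z' x) z - a\<^sup>2 / 2 * Q_kernel n g a z x
       = H_BC n g (\<lambda>x'. Q_kernel n g a z x') x"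
proof -
  define \<alpha> where "\<alpha> = \<i> * a"
  define s where "s = csqrt (g 2 / 2)"
  define u where "u = complex_of_real (exp (z 1))"
  define X where "X = complex_of_real (exp (x 1))"
  define p where "p = (1 + u\<^sup>2) / (1 - u\<^sup>2)"
  define q where "q = - 2 * u / (1 - u\<^sup>2)"
  define C where "C = s * X * (u + 1 / u)"
  define D where "D = s * X * (u - 1 / u)"
  define Q where "Q = Q_kernel n g a z x"
  define A where "A = A_term g z x"
  define B where "B = B_term n g z x"
  define Sz where "Sz = (\<Sum>j=1..n. (\<alpha> - A j + B (j+1))\<^sup>2 - A j - B (j+1))"
  define Sx where "Sx = (\<Sum>j=1..n. (- \<alpha> + A j - B j)\<^sup>2 - A j - B j)"
  define Vx where "Vx = (\<Sum>k=1..n-1. g (k+2) * complex_of_real (exp (x (k+1) - x k)))"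
  define Vz where "Vz = (\<Sum>k=2..n. g (k+2) * complex_of_real (exp (z (k+1) - z k)))"
  have u: "u \<noteq> 0" "u\<^sup>2 \<noteq> 1"
    using assms(3) by (simp_all add: u_def flip: of_real_power exp_double)
  \<comment> \<open>These turn the remainder \<open>2 * s * \<kappa> * X + 2 * s^2 * X^2\<close> of
    \<open>boundary_identity\<close> into the boundary potential of \<open>H_BC\<close>.\<close>
  have \<kappa>: "2 * s * kappa g = g 1" and g2: "2 * s\<^sup>2 = g 2"
    using assms(2) by (simp_all add: kappa_def csqrt_double s_def)
  have B1: "B 1 = C"
    by (simp add: B_def B_term_def C_def s_def X_def u_def exp_add exp_diff algebra_simps)
  have Bn: "B (n + 1) = 0"
    using assms(1) by (simp add: B_def B_term_def)
  \<comment> \<open>In \<open>A j * B (j+1)\<close> the variable \<open>z (j+1)\<close> cancels,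
    leaving \<open>exp (x (j+1) - x j)\<close>; the summand \<open>j = n\<close> is zero.\<close>
  have "(\<Sum>j=1..n. A j * B (j+1)) = (\<Sum>j=1..n-1. A j * B (j+1))"
    using assms(1) Bn by (cases n) simp_all
  also have "\<dots> = Vx"
    unfolding Vx_def by (rule sum.cong)
      (auto simp: A_def B_def A_term_def B_term_def mult.assoc simp flip: of_real_mult exp_add)
  finally have AB1: "(\<Sum>j=1..n. A j * B (j+1)) = Vx" .
  \<comment> \<open>In \<open>A j * B j\<close> it is \<open>x j\<close> that cancels; the index 1
    is split off because \<open>B 1\<close> has its own form.\<close>
  have "{1..n} = insert 1 {2..n}" using assms(1) by auto
  then have "(\<Sum>j=1..n. A j * B j) = A 1 * B 1 + (\<Sum>j=2..n. A j * B j)"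
    by simp
  also have "(\<Sum>j=2..n. A j * B j) = Vz"
    unfolding Vz_def by (rule sum.cong)
      (auto simp: A_def B_def A_term_def B_term_def mult.assoc simp flip: of_real_mult exp_add)
  also have "A 1 * B 1 = g 3 * s * complex_of_real (exp (z 1 + z 2) + exp (z 2 - z 1))"
    by (simp add: A_def B_def A_term_def B_term_def s_def exp_add exp_diff numeral_eq_Suc field_simps)
  finally have AB2: "(\<Sum>j=1..n. A j * B j)
      = g 3 * s * complex_of_real (exp (z 1 + z 2) + exp (z 2 - z 1)) + Vz" .
  have tele: "Sz = Sx - (C\<^sup>2 + 2 * \<alpha> * C - C) - 2 * Vx
      + 2 * (g 3 * s * complex_of_real (exp (z 1 + z 2) + exp (z 2 - z 1)) + Vz)"
    unfolding Sz_def Sx_def sum_squares_telescope AB1 AB2 B1 Bn by simp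
  have Lx: "laplacian n (\<lambda>x'. Q_kernel n g a z x') x = Sx * Q"
    unfolding laplacian_def Sx_def sum_distrib_right
    by (rule sum.cong) (auto simp only: Q_kernel_second_derivative_x \<alpha>_def A_def B_def Q_def)
  have "laplacian (n+1) (\<lambda>z'. Q_kernel n g a z' x) z
      = partial_derivative 1 (partial_derivative 1 (\<lambda>z'. Q_kernel n g a z' x)) z
        + (\<Sum>j=1..n. partial_derivative (j+1) (partial_derivative (j+1) (\<lambda>z'. Q_kernel n g a z' x)) z)"
    unfolding laplacian_def
    by (subst sum.atLeast_Suc_atMost) (simp_all add: sum.shift_bounds_cl_Suc_ivl del: sum.cl_ivl_Suc)
  also have "(\<Sum>j=1..n. partial_derivative (j+1) (partial_derivative (j+1) (\<lambda>z'. Q_kernel n g a z' x)) z)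
      = Sz * Q"
    unfolding Sz_def sum_distrib_right
    by (rule sum.cong) (auto simp only: Q_kernel_second_derivative_z \<alpha>_def A_def B_def Q_def)
  also have "partial_derivative 1 (partial_derivative 1 (\<lambda>z'. Q_kernel n g a z' x)) z
      = (\<alpha> * q\<^sup>2 + kappa g * (p * q) - C + (\<alpha> * p + kappa g * q - D)\<^sup>2) * Q"
    unfolding \<alpha>_def q_def p_def C_def D_def s_def X_def u_def Q_def
    by (rule Q_kernel_second_derivative_z1[of n z, OF assms(1,3)])
  finally have Lz: "laplacian (n+1) (\<lambda>z'. Q_kernel n g a z' x) z
      = (\<alpha> * q\<^sup>2 + kappa g * (p * q) - C + (\<alpha> * p + kappa g * q - D)\<^sup>2) * Q + Sz * Q" .
  have d1: "complex_of_real ((exp (- z 1 / 2) - exp (z 1 / 2))\<^sup>2) = 1 / u - 2 + u"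
  proof -
    have "(exp (- z 1 / 2) - exp (z 1 / 2))\<^sup>2 = exp (- z 1) - 2 + exp (z 1)"
      by (simp add: power2_diff mult.assoc flip: exp_double exp_add)
    then show ?thesis
      by (simp add: u_def exp_minus inverse_eq_divide)
  qed
  have d2: "complex_of_real ((exp (- z 1) - exp (z 1))\<^sup>2) = (1 / u - u)\<^sup>2"
    by (simp add: u_def exp_minus inverse_eq_divide)
  have X2: "complex_of_real (exp (2 * x 1)) = X\<^sup>2"
    by (simp add: X_def exp_double)
  have bd: "- (1/2) * (\<alpha> * q\<^sup>2 + kappa g * (p * q) - C + (\<alpha> * p + kappa g * q - D)\<^sup>2)
      + g1_tilde g a / (1 / u - 2 + u) + g2_tilde g a / (1 / u - u)\<^sup>2 - a\<^sup>2 / 2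
    = - (1/2) * (C\<^sup>2 + 2 * \<alpha> * C - C) + g 1 * X + g 2 * X\<^sup>2"
  proof -
    \<comment> \<open>The shift of the Hamiltonian by \<open>- a^2 / 2\<close> is the summand
      \<open>\<alpha>^2 / 2\<close> of \<open>boundary_identity\<close>.\<close>
    have a: "- (a\<^sup>2 / 2) = \<alpha>\<^sup>2 / 2"
      by (simp add: \<alpha>_def power_mult_distrib)
    show ?thesis
      using boundary_identity[OF u, of \<alpha> "kappa g" s X, folded p_def q_def C_def D_def]
      unfolding diff_conv_add_uminus[of _ "a\<^sup>2 / 2"] a \<kappa> g2
      by (simp add: g1_tilde_def g2_tilde_def \<alpha>_def mult.assoc)
  qed
  define T1 T2 where "T1 = g1_tilde g a / (1 / u - 2 + u)" and "T2 = g2_tilde g a / (1 / u - u)\<^sup>2"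
  define K where "K = \<alpha> * q\<^sup>2 + kappa g * (p * q) - C + (\<alpha> * p + kappa g * q - D)\<^sup>2"
  define M where "M = g 3 * s * complex_of_real (exp (z 1 + z 2) + exp (z 2 - z 1))"
  have "H_I n g a (\<lambda>z'. Q_kernel n g a z' x) z - a\<^sup>2 / 2 * Q
      = (- (1/2) * K + T1 + T2 - a\<^sup>2 / 2 - (1/2) * Sz + M + Vz) * Q"
    unfolding H_I_def Lz d1 d2
    by (simp add: T1_def T2_def K_def M_def Vz_def s_def Q_def algebra_simps)
  also have "- (1/2) * K + T1 + T2 - a\<^sup>2 / 2 = - (1/2) * (C\<^sup>2 + 2 * \<alpha> * C - C) + g 1 * X + g 2 * X\<^sup>2"
    using bd unfolding K_def T1_def T2_def .
  \<comment> \<open>By \<open>tele\<close>, \<open>- (1/2) * Sz\<close> supplies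
    \<open>(1/2) * (C^2 + 2 * \<alpha> * C - C)\<close>, which cancels the remainder from
    \<open>z 1\<close>, and exchanges the potential \<open>M + Vz\<close> for
    \<open>Vx\<close>.\<close>
  also have "\<dots> - (1/2) * Sz + M + Vz = - (1/2) * Sx + g 1 * X + g 2 * X\<^sup>2 + Vx"
    unfolding tele M_def[symmetric] by (simp add: field_simps)
  also have "\<dots> * Q = H_BC n g (\<lambda>x'. Q_kernel n g a z x') x"
    unfolding H_BC_def Lx X2 X_def[symmetric] Vx_def[symmetric] Q_def[symmetric]
    by (simp add: algebra_simps)
  finally show ?thesis unfolding Q_def .
qed

end
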